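(* Let $L:V\to V_\Gamma$ be a linear (discrete boundary) operator, not necessarily of full rank, let $L^+$ be its pseudoinverse and let $P=I-L^+L$. Let $g\in V_\Gamma$ and let $\tilde g\in V$ satisfy $L\tilde g=g$. Then for $v\in V$, $$(I-P)(v-\tilde g)=0\quad\Longleftrightarrow\quad Lv=g.$$
   Context: $V=\mathbb{R}^{(N+1)d}$ is the state space with inner product $(u,v)=u^THv$, $H$ symmetric positive definite; $V_\Gamma=\mathbb{R}^{2d}$ is the boundary state space with the Euclidean inner product. $L$ is represented by a matrix in $\mathbb{R}^{2d\times(N+1)d}$. The adjoint $L^*:V_\Gamma\to V$ is defined by $(v,L^*z)=\langle Lv,z\rangle$, and the pseudoinverse is $L^+=\lim_{\delta\to0}(L^*L+\delta^2I)^{-1}L^*$; equivalently, $L^+$ is the unique linear operator with $LL^+L=L$, $L^+LL^+=L^+$, and $L^+L$, $LL^+$ self-adjoint in the respective inner products. *)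

theory Defs
  imports "HOL-Analysis.Analysis"
begin

text \<open>
  Indexing convention: a state in \<open>V\<close> assigns \<open>d\<close> real components to each of the \<open>N + 1\<close> grid
  points, so \<open>V\<close> is modelled as \<open>real ^ ('n \<times> 'd)\<close> with \<open>CARD('n) = N + 1\<close> and \<open>CARD('d) = d\<close>;
  boundary states have \<open>d\<close> components at each of two boundary points and live in
  \<open>real ^ (2 \<times> 'd)\<close>.  The definitions below do not depend on this product structure.
\<close>

definition sym_pos_def :: "real ^ 'a ^ 'a \<Rightarrow> bool" where
  "sym_pos_def H \<longleftrightarrow> transpose H = H \<and> (\<forall>x. x \<noteq> 0 \<longrightarrow> x \<bullet> (H *v x) > 0)"

definition weighted_inner :: "real ^ 'a ^ 'a \<Rightarrow> real ^ 'a \<Rightarrow> real ^ 'a \<Rightarrow> real" where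
  "weighted_inner H u v = u \<bullet> (H *v v)"

text \<open>
  The domain carries the \<open>H\<close>-weighted inner product and the codomain the Euclidean one, hence the
  library constant \<^const>\<open>adjoint\<close>, which is Euclidean on both sides, does not apply.  The matrix is
  unique when \<open>H\<close> is symmetric positive definite.
\<close>

definition weighted_adjoint :: "real ^ 'a ^ 'a \<Rightarrow> real ^ 'a ^ 'b \<Rightarrow> real ^ 'b ^ 'a" where
  "weighted_adjoint H L = (THE M. \<forall>v z. weighted_inner H v (M *v z) = (L *v v) \<bullet> z)"

definition weighted_pinv :: "real ^ 'a ^ 'a \<Rightarrow> real ^ 'a ^ 'b \<Rightarrow> real ^ 'b ^ 'a" where
  "weighted_pinv H L =
     Lim (at (0::real))
       (\<lambda>\<delta>. matrix_inv (weighted_adjoint H L ** L + \<delta>\<^sup>2 *\<^sub>R mat 1) ** weighted_adjoint H L)"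

end

theory Submission
  imports Defs
begin

text \<open>
  Since \<open>I - P = L\<^sup>+ L\<close> and \<open>g = L g\<^sub>t\<close>, the claim says that \<open>L\<^sup>+ L\<close> and \<open>L\<close> have the same kernel.
  One inclusion is trivial and the other follows from the Penrose identity \<open>L L\<^sup>+ L = L\<close>
  (\<open>weighted_pinv_Penrose\<close>).  As \<open>L\<^sup>+\<close> is defined by a limit, the work lies in showing that the limit
  exists and has this property.

  Put \<open>A = L\<^sup>* L\<close>.  Because \<open>A\<close> is self-adjoint and has the same kernel as \<open>L\<close>, the range of
  \<open>L\<^sup>*\<close> equals that of \<open>A\<^sup>2\<close>, so \<open>L\<^sup>* = A\<^sup>2 U\<close> for some matrix \<open>U\<close>
  (\<open>weighted_adjoint_factor_square\<close>).  Dividing \<open>A\<^sup>2\<close> by \<open>A + \<delta>\<^sup>2 I\<close> with remainder gives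
    \<open>(A + \<delta>\<^sup>2 I)\<^sup>-\<^sup>1 L\<^sup>* = A U - \<delta>\<^sup>2 U + \<delta>\<^sup>4 (A + \<delta>\<^sup>2 I)\<^sup>-\<^sup>1 U\<close>.
  Coercivity of \<open>A + \<delta>\<^sup>2 I\<close> bounds its inverse by a multiple of \<open>\<delta>\<^sup>-\<^sup>2\<close>, so the last two terms vanish
  in the limit and \<open>L\<^sup>+ = A U\<close>.  Then \<open>A L\<^sup>+ L = L\<^sup>* L = A\<close>, and equality of the kernels of
  \<open>A\<close> and \<open>L\<close> turns this into \<open>L L\<^sup>+ L = L\<close>.
\<close>

section \<open>Matrices and their action on vectors\<close>

lemma matrix_tendstoI:
  fixes M :: "'t \<Rightarrow> real ^ 'a::finite ^ 'b::finite"
  assumes "\<And>z. ((\<lambda>t. M t *v z) \<longlongrightarrow> W *v z) F"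
  shows "(M \<longlongrightarrow> W) F"
proof (intro vec_tendstoI)
  fix i j
  have "((\<lambda>t. (M t *v axis j 1) $ i) \<longlongrightarrow> (W *v axis j 1) $ i) F"
    by (intro tendsto_vec_nth assms)
  then show "((\<lambda>t. M t $ i $ j) \<longlongrightarrow> W $ i $ j) F"
    by (simp add: matrix_vector_mult_basis column_def)
qed

lemma
  fixes M :: "real ^ 'a::finite ^ 'b::finite"
  assumes "invertible M"
  shows matrix_inv_right: "M ** matrix_inv M = mat 1"
    and matrix_inv_left: "matrix_inv M ** M = mat 1"
proof -
  have "M ** matrix_inv M = mat 1 \<and> matrix_inv M ** M = mat 1"
    unfolding matrix_inv_def by (rule someI_ex) (use assms in \<open>simp add: invertible_def\<close>)
  then show "M ** matrix_inv M = mat 1" "matrix_inv M ** M = mat 1"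
    by auto
qed

lemma inner_transpose_matrix:
  fixes M :: "real ^ 'a::finite ^ 'b::finite"
  shows "x \<bullet> (transpose M *v y) = (M *v x) \<bullet> y"
  using dot_lmul_matrix[of y M x] by (simp add: inner_commute)

lemma matrix_factor_if_range_subset:
  fixes Q :: "real ^ 'a::finite ^ 'c::finite" and C :: "real ^ 'b::finite ^ 'c"
  assumes "\<And>z. \<exists>u. Q *v u = C *v z"
  shows "\<exists>U. C = Q ** U"
proof -
  obtain u where u: "\<And>z. Q *v u z = C *v z"
    using assms by metis
  have "(Q ** (\<chi> k j. u (axis j 1) $ k)) $ i $ j = C $ i $ j" for i j
  proof -
    have "(Q ** (\<chi> k j. u (axis j 1) $ k)) $ i $ j = (Q *v u (axis j 1)) $ i"
      by (simp add: matrix_matrix_mult_def matrix_vector_mult_def)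
    also have "\<dots> = C $ i $ j"
      by (simp add: u matrix_vector_mult_basis column_def)
    finally show ?thesis .
  qed
  then show ?thesis
    by (metis vec_eq_iff)
qed

text \<open>
  The range of a symmetric matrix is the orthogonal complement of its kernel: the part of \<open>y\<close>
  orthogonal to the range lies in the kernel, hence is orthogonal to \<open>y\<close> and so to itself.
\<close>

lemma symmetric_matrix_rangeI:
  fixes Q :: "real ^ 'a::finite ^ 'a"
  assumes sym: "transpose Q = Q" and orth: "\<And>x. Q *v x = 0 \<Longrightarrow> x \<bullet> y = 0"
  shows "\<exists>u. Q *v u = y"
proof -
  have sub: "subspace (range ((*v) Q))"
    by (simp add: linear_subspace_image)
  obtain y1 y2 where y1: "y1 \<in> span (range ((*v) Q))"
    and y2: "\<And>w. w \<in> span (range ((*v) Q)) \<Longrightarrow> orthogonal y2 w" and y: "y = y1 + y2"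
    using orthogonal_subspace_decomp_exists[of "range ((*v) Q)" y] by metis
  have "(Q *v y2) \<bullet> x = 0" for x
  proof -
    have "(Q *v y2) \<bullet> x = y2 \<bullet> (Q *v x)"
      by (metis inner_transpose_matrix sym)
    then show ?thesis
      using y2[of "Q *v x"] by (simp add: orthogonal_def span_base)
  qed
  then have "y2 \<bullet> y = 0"
    using orth by (metis inner_eq_zero_iff)
  moreover have "y2 \<bullet> y1 = 0"
    using y2[OF y1] by (simp add: orthogonal_def)
  ultimately have "y2 = 0"
    by (simp add: y inner_add_right)
  then have "y \<in> range ((*v) Q)"
    using y1 y by (simp only: span_eq_iff[THEN iffD2, OF sub] add_0_right)
  then show ?thesis
    by (auto simp: image_iff)
qed

section \<open>The weighted inner product and the weighted adjoint\<close>

lemma sym_pos_def_coercive: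
  fixes H :: "real ^ 'a::finite ^ 'a"
  assumes "sym_pos_def H"
  obtains c where "c > 0" "\<And>x. c * (norm x)\<^sup>2 \<le> x \<bullet> (H *v x)"
proof -
  have "continuous_on (sphere 0 1) (\<lambda>x. x \<bullet> (H *v x))"
    by (intro continuous_intros)
  moreover have "sphere (0 :: real ^ 'a) 1 \<noteq> {}"
    using vector_choose_size[of 1] by auto
  ultimately obtain e where e: "norm e = 1" "\<And>y. norm y = 1 \<Longrightarrow> e \<bullet> (H *v e) \<le> y \<bullet> (H *v y)"
    using continuous_attains_inf[of "sphere 0 1" "\<lambda>x. x \<bullet> (H *v x)"] by (auto simp: dist_norm)
  have "(e \<bullet> (H *v e)) * (norm x)\<^sup>2 \<le> x \<bullet> (H *v x)" for x
  proof (cases "x = 0")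
    case False
    define y where "y = (1 / norm x) *\<^sub>R x"
    have "norm y = 1" and "y \<bullet> (H *v y) = (x \<bullet> (H *v x)) / (norm x)\<^sup>2"
      using False by (simp_all add: y_def matrix_vector_mult_scaleR power2_eq_square)
    then have "x \<bullet> (H *v x) = (norm x)\<^sup>2 * (y \<bullet> (H *v y))"
      using False by simp
    then show ?thesis
      using mult_right_mono[OF e(2)[OF \<open>norm y = 1\<close>], of "(norm x)\<^sup>2"]
      by (simp add: mult.commute)
  qed simp
  moreover have "e \<bullet> (H *v e) > 0"
    using assms e(1) unfolding sym_pos_def_def by (metis norm_zero zero_neq_one)
  ultimately show thesis
    using that by blast
qed

lemma sym_pos_def_invertible:
  fixes H :: "real ^ 'a::finite ^ 'a"
  assumes "sym_pos_def H"
  shows "invertible H"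
proof -
  have "H *v x = 0 \<Longrightarrow> x = 0" for x
    using assms unfolding sym_pos_def_def by (metis inner_zero_right less_irrefl)
  then show ?thesis
    by (meson invertible_left_inverse matrix_left_invertible_ker)
qed

lemma weighted_adjoint_eq:
  fixes H :: "real ^ 'a::finite ^ 'a" and L :: "real ^ 'a ^ 'b::finite"
  assumes "sym_pos_def H"
  shows "weighted_adjoint H L = matrix_inv H ** transpose L"
  unfolding weighted_adjoint_def
proof (rule the_equality)
  note inv = sym_pos_def_invertible[OF assms]
  have "H ** (matrix_inv H ** transpose L) = transpose L"
    by (simp add: matrix_mul_assoc matrix_inv_right[OF inv])
  then have "H *v ((matrix_inv H ** transpose L) *v z) = transpose L *v z" for z
    by (metis matrix_vector_mul_assoc)
  then show "\<forall>v z. weighted_inner H v ((matrix_inv H ** transpose L) *v z) = (L *v v) \<bullet> z"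
    by (simp only: weighted_inner_def inner_transpose_matrix simp_thms)
  fix M assume M: "\<forall>v z. weighted_inner H v (M *v z) = (L *v v) \<bullet> z"
  have "H *v (M *v z) = transpose L *v z" for z
    using M unfolding weighted_inner_def inner_transpose_matrix[symmetric]
    by (intro iffD1[OF vector_eq_ldot]) blast
  then have "H ** M = transpose L"
    by (simp only: matrix_eq matrix_vector_mul_assoc[symmetric] simp_thms)
  then have "matrix_inv H ** (H ** M) = matrix_inv H ** transpose L"
    by simp
  then show "M = matrix_inv H ** transpose L"
    by (simp add: matrix_mul_assoc matrix_inv_left[OF inv])
qed

lemma inner_weighted_adjoint:
  fixes H :: "real ^ 'a::finite ^ 'a" and L :: "real ^ 'a ^ 'b::finite"
  assumes "sym_pos_def H"
  shows "v \<bullet> (H *v (weighted_adjoint H L *v z)) = (L *v v) \<bullet> z"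
proof -
  have "H ** weighted_adjoint H L = transpose L"
    by (simp add: weighted_adjoint_eq[OF assms] matrix_mul_assoc
        matrix_inv_right[OF sym_pos_def_invertible[OF assms]])
  then show ?thesis
    by (simp only: matrix_vector_mul_assoc inner_transpose_matrix)
qed

lemma weighted_adjoint_mult_eq_0_iff:
  fixes H :: "real ^ 'a::finite ^ 'a" and L :: "real ^ 'a ^ 'b::finite"
  assumes "sym_pos_def H"
  shows "weighted_adjoint H L *v (L *v x) = 0 \<longleftrightarrow> L *v x = 0"
  using inner_weighted_adjoint[OF assms, of x L "L *v x"] by auto

text \<open>
  Multiplying by \<open>H\<close> turns the equation into \<open>L\<^sup>T = Q U\<close> with \<open>Q = H (L\<^sup>* L)\<^sup>2\<close>, which is symmetric for
  the Euclidean inner product.  It is solvable column by column, since \<open>Q x = 0\<close> forces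
  \<open>L x = 0\<close> and hence \<open>x\<close> is orthogonal to the range of \<open>L\<^sup>T\<close>.
\<close>

lemma weighted_adjoint_factor_square:
  fixes H :: "real ^ 'a::finite ^ 'a" and L :: "real ^ 'a ^ 'b::finite"
  assumes H: "sym_pos_def H"
  defines "A \<equiv> weighted_adjoint H L ** L"
  shows "\<exists>U. weighted_adjoint H L = A ** (A ** U)"
proof -
  note inv = sym_pos_def_invertible[OF H]
  note adj = inner_weighted_adjoint[OF H]
  have symA: "v \<bullet> (H *v (A *v w)) = (L *v v) \<bullet> (L *v w)" for v w
    using adj[of v L "L *v w"] by (simp add: A_def matrix_vector_mul_assoc)
  have kerA: "A *v x = 0 \<Longrightarrow> L *v x = 0" for x
    using weighted_adjoint_mult_eq_0_iff[OF H] by (metis A_def matrix_vector_mul_assoc)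
  have cancelH: "x = y" if "H *v x = H *v y" for x y
    using that inv by (metis matrix_inv_left matrix_vector_mul_assoc matrix_vector_mul_lid)
  define Q where "Q = H ** (A ** A)"
  have Qv: "Q *v x = H *v (A *v (A *v x))" for x
    by (simp add: Q_def matrix_vector_mul_assoc matrix_mul_assoc)
  have selfadj: "v \<bullet> (H *v (A *v w)) = w \<bullet> (H *v (A *v v))" for v w
    using symA[of v w] symA[of w v] by (simp add: inner_commute)
  have Hsym: "v \<bullet> (H *v w) = w \<bullet> (H *v v)" for v w
    using H unfolding sym_pos_def_def by (metis inner_transpose_matrix inner_commute)
  have Qsym: "v \<bullet> (Q *v w) = w \<bullet> (Q *v v)" for v w
    unfolding Qv by (metis selfadj Hsym)
  have "v \<bullet> (transpose Q *v w) = v \<bullet> (Q *v w)" for v w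
    unfolding inner_transpose_matrix by (simp add: Qsym[of v w] inner_commute)
  then have "transpose Q *v w = Q *v w" for w
    by (intro iffD1[OF vector_eq_ldot]) blast
  then have "transpose Q = Q"
    by (simp only: matrix_eq simp_thms)
  have kerQ: "L *v x = 0" if "Q *v x = 0" for x
  proof -
    have "A *v (A *v x) = 0"
      using that cancelH[of "A *v (A *v x)" 0] by (simp add: Qv)
    then have "(L *v x) \<bullet> (L *v (A *v x)) = 0"
      using symA[of x "A *v x"] by simp
    then have "(A *v x) \<bullet> (H *v (A *v x)) = 0"
      using symA[of "A *v x" x] by (simp add: inner_commute)
    then show ?thesis
      using H kerA unfolding sym_pos_def_def by (metis less_irrefl)
  qed
  have "\<exists>u. Q *v u = (H ** weighted_adjoint H L) *v z" for z
  proof (rule symmetric_matrix_rangeI[OF \<open>transpose Q = Q\<close>])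
    show "x \<bullet> ((H ** weighted_adjoint H L) *v z) = 0" if "Q *v x = 0" for x
      using kerQ[OF that] adj[of x L z] by (simp add: matrix_vector_mul_assoc)
  qed
  then obtain U where "H ** weighted_adjoint H L = Q ** U"
    using matrix_factor_if_range_subset by blast
  then have "H *v (weighted_adjoint H L *v z) = H *v ((A ** (A ** U)) *v z)" for z
    by (simp add: Q_def matrix_vector_mul_assoc matrix_mul_assoc)
  then have "weighted_adjoint H L = A ** (A ** U)"
    using cancelH by (metis matrix_eq)
  then show ?thesis ..
qed

section \<open>The regularised inverse and the pseudoinverse\<close>

text \<open>
  Pairing \<open>(L\<^sup>* L + \<delta>\<^sup>2 I) x\<close> with \<open>x\<close> in the weighted inner product and dropping the nonnegative
  term \<open>\<parallel>L x\<parallel>\<^sup>2\<close> leaves \<open>\<delta>\<^sup>2 (x, x)\<close>, so the estimate does not depend on the rank of \<open>L\<close>.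
\<close>

lemma regularised_normal_bound:
  fixes H :: "real ^ 'a::finite ^ 'a" and L :: "real ^ 'a ^ 'b::finite"
  assumes H: "sym_pos_def H" and c: "\<And>x. c * (norm x)\<^sup>2 \<le> x \<bullet> (H *v x)"
  shows "c * \<delta>\<^sup>2 * norm x \<le> norm (H *v ((weighted_adjoint H L ** L + \<delta>\<^sup>2 *\<^sub>R mat 1) *v x))"
    (is "_ \<le> norm (H *v ?y)")
proof (cases "x = 0")
  case False
  have y: "?y = weighted_adjoint H L *v (L *v x) + \<delta>\<^sup>2 *\<^sub>R x"
    by (simp add: matrix_vector_mult_add_rdistrib matrix_vector_mul_assoc
        scaleR_matrix_vector_assoc[symmetric])
  have "x \<bullet> (H *v ?y) = (L *v x) \<bullet> (L *v x) + \<delta>\<^sup>2 * (x \<bullet> (H *v x))"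
    unfolding y matrix_vector_right_distrib inner_add_right inner_weighted_adjoint[OF H]
    by (simp add: matrix_vector_mult_scaleR)
  moreover have "\<delta>\<^sup>2 * (c * (norm x)\<^sup>2) \<le> \<delta>\<^sup>2 * (x \<bullet> (H *v x))"
    by (intro mult_left_mono c) simp
  moreover have "x \<bullet> (H *v ?y) \<le> norm x * norm (H *v ?y)"
    by (rule norm_cauchy_schwarz)
  ultimately have "\<delta>\<^sup>2 * (c * (norm x)\<^sup>2) \<le> norm x * norm (H *v ?y)"
    using inner_ge_zero[of "L *v x"] by linarith
  then have "norm x * (c * \<delta>\<^sup>2 * norm x) \<le> norm x * norm (H *v ?y)"
    by (simp add: power2_eq_square mult_ac)
  then show ?thesis
    using False by simp
qed simp

lemma weighted_pinv_tendsto: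
  fixes H :: "real ^ 'a::finite ^ 'a" and L :: "real ^ 'a ^ 'b::finite"
  assumes H: "sym_pos_def H"
  defines "A \<equiv> weighted_adjoint H L ** L"
  assumes U: "weighted_adjoint H L = A ** (A ** U)"
  shows "((\<lambda>\<delta>. matrix_inv (A + \<delta>\<^sup>2 *\<^sub>R mat 1) ** weighted_adjoint H L) \<longlongrightarrow> A ** U) (at (0::real))"
proof (rule matrix_tendstoI)
  fix z
  define u where "u = U *v z"
  define R where "R \<delta> = matrix_inv (A + \<delta>\<^sup>2 *\<^sub>R mat 1)" for \<delta> :: real
  obtain c where c: "c > 0" "\<And>x. c * (norm x)\<^sup>2 \<le> x \<bullet> (H *v x)"
    using sym_pos_def_coercive[OF H] by blast
  note bound = regularised_normal_bound[OF H c(2), of _ _ L, folded A_def]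
  have inv: "invertible (A + \<delta>\<^sup>2 *\<^sub>R mat 1)" if "\<delta> \<noteq> 0" for \<delta> :: real
  proof -
    have "x = 0" if "(A + \<delta>\<^sup>2 *\<^sub>R mat 1) *v x = 0" for x
    proof -
      have "c * \<delta>\<^sup>2 * norm x \<le> 0"
        using bound[of \<delta> x] that by simp
      moreover have "c * \<delta>\<^sup>2 > 0"
        using c(1) \<open>\<delta> \<noteq> 0\<close> by simp
      ultimately show ?thesis
        by (metis mult_le_0_iff not_less norm_le_zero_iff)
    qed
    then show ?thesis
      by (meson invertible_left_inverse matrix_left_invertible_ker)
  qed
  have expand: "(R \<delta> ** weighted_adjoint H L) *v z = A *v u - \<delta>\<^sup>2 *\<^sub>R u + \<delta>^4 *\<^sub>R (R \<delta> *v u)"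
    if "\<delta> \<noteq> 0" for \<delta>
  proof -
    let ?B = "A + \<delta>\<^sup>2 *\<^sub>R mat 1"
    have B: "?B *v x = A *v x + \<delta>\<^sup>2 *\<^sub>R x" for x
      by (simp add: matrix_vector_mult_add_rdistrib scaleR_matrix_vector_assoc[symmetric])
    have RB: "R \<delta> *v (?B *v x) = x" for x
      using matrix_inv_left[OF inv[OF that]] by (simp add: R_def matrix_vector_mul_assoc)
    \<comment> \<open>Division with remainder: \<open>t\<^sup>2 = (t + \<delta>\<^sup>2) (t - \<delta>\<^sup>2) + \<delta>\<^sup>4\<close>, evaluated at \<open>A\<close>.\<close>
    have "weighted_adjoint H L *v z = A *v (A *v u)"
      by (subst U) (simp add: u_def matrix_vector_mul_assoc matrix_mul_assoc)
    also have "\<dots> = ?B *v (A *v u - \<delta>\<^sup>2 *\<^sub>R u) + \<delta>^4 *\<^sub>R u"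
      unfolding B by (simp add: matrix_vector_mult_diff_distrib matrix_vector_mult_scaleR
          scaleR_diff_right flip: power_add)
    finally show ?thesis
      by (simp add: matrix_vector_mul_assoc[symmetric] matrix_vector_right_distrib RB
          matrix_vector_mult_scaleR)
  qed
  have "((\<lambda>\<delta>. \<delta>^4 *\<^sub>R (R \<delta> *v u)) \<longlongrightarrow> 0) (at 0)"
  proof (rule Lim_null_comparison)
    have "norm (\<delta>^4 *\<^sub>R (R \<delta> *v u)) \<le> \<delta>\<^sup>2 * (norm (H *v u) / c)" if "\<delta> \<noteq> 0" for \<delta>
    proof -
      have "(A + \<delta>\<^sup>2 *\<^sub>R mat 1) *v (R \<delta> *v u) = u"
        using matrix_inv_right[OF inv[OF that]] by (simp add: R_def matrix_vector_mul_assoc)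
      then have "c * \<delta>\<^sup>2 * norm (R \<delta> *v u) \<le> norm (H *v u)"
        using bound[of \<delta> "R \<delta> *v u"] by simp
      then have "\<delta>\<^sup>2 * norm (R \<delta> *v u) \<le> norm (H *v u) / c"
        using c(1) by (simp add: pos_le_divide_eq mult_ac)
      then have "\<delta>\<^sup>2 * (\<delta>\<^sup>2 * norm (R \<delta> *v u)) \<le> \<delta>\<^sup>2 * (norm (H *v u) / c)"
        by (intro mult_left_mono) auto
      moreover have "norm (\<delta>^4 *\<^sub>R (R \<delta> *v u)) = \<delta>\<^sup>2 * (\<delta>\<^sup>2 * norm (R \<delta> *v u))"
        by simp
      ultimately show ?thesis
        by simp
    qed
    then show "\<forall>\<^sub>F \<delta> in at 0. norm (\<delta>^4 *\<^sub>R (R \<delta> *v u)) \<le> \<delta>\<^sup>2 * (norm (H *v u) / c)"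
      by (auto simp: eventually_at_filter)
    show "((\<lambda>\<delta>. \<delta>\<^sup>2 * (norm (H *v u) / c)) \<longlongrightarrow> 0) (at 0)"
      by (intro tendsto_mult_left_zero) (auto intro!: tendsto_eq_intros)
  qed
  moreover have "((\<lambda>\<delta>. A *v u - \<delta>\<^sup>2 *\<^sub>R u) \<longlongrightarrow> A *v u) (at (0::real))"
    by (auto intro!: tendsto_eq_intros)
  ultimately have "((\<lambda>\<delta>. A *v u - \<delta>\<^sup>2 *\<^sub>R u + \<delta>^4 *\<^sub>R (R \<delta> *v u)) \<longlongrightarrow> A *v u) (at 0)"
    using tendsto_add[of "\<lambda>\<delta>. A *v u - \<delta>\<^sup>2 *\<^sub>R u" "A *v u" "at 0" _ 0] by simp
  moreover have "\<forall>\<^sub>F \<delta> in at 0. A *v u - \<delta>\<^sup>2 *\<^sub>R u + \<delta>^4 *\<^sub>R (R \<delta> *v u)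
      = (R \<delta> ** weighted_adjoint H L) *v z"
    by (auto simp: eventually_at_filter expand)
  ultimately have "((\<lambda>\<delta>. (R \<delta> ** weighted_adjoint H L) *v z) \<longlongrightarrow> A *v u) (at 0)"
    by (rule Lim_transform_eventually)
  then show "((\<lambda>\<delta>. (matrix_inv (A + \<delta>\<^sup>2 *\<^sub>R mat 1) ** weighted_adjoint H L) *v z)
      \<longlongrightarrow> (A ** U) *v z) (at 0)"
    by (simp add: R_def u_def matrix_vector_mul_assoc)
qed

lemma weighted_pinv_Penrose:
  fixes H :: "real ^ 'a::finite ^ 'a" and L :: "real ^ 'a ^ 'b::finite"
  assumes H: "sym_pos_def H"
  shows "L *v (weighted_pinv H L *v (L *v x)) = L *v x"
proof -
  let ?A = "weighted_adjoint H L ** L"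
  obtain U where U: "weighted_adjoint H L = ?A ** (?A ** U)"
    using weighted_adjoint_factor_square[OF H] by blast
  have "weighted_pinv H L = ?A ** U"
    unfolding weighted_pinv_def
    by (intro tendsto_Lim weighted_pinv_tendsto[OF H U]) simp
  then have "?A ** weighted_pinv H L = weighted_adjoint H L"
    using U by simp
  then have "weighted_adjoint H L *v (L *v (weighted_pinv H L *v (L *v x)))
      = weighted_adjoint H L *v (L *v x)"
    by (metis matrix_vector_mul_assoc)
  then have "weighted_adjoint H L *v (L *v (weighted_pinv H L *v (L *v x) - x)) = 0"
    by (simp add: matrix_vector_mult_diff_distrib)
  then show ?thesis
    by (simp only: weighted_adjoint_mult_eq_0_iff[OF H])
      (simp add: matrix_vector_mult_diff_distrib)
qed

theorem theorem47:
  fixes H :: "real ^ ('n::finite \<times> 'd::finite) ^ ('n \<times> 'd)"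
    and L :: "real ^ ('n \<times> 'd) ^ (2 \<times> 'd)"
    and P :: "real ^ ('n \<times> 'd) ^ ('n \<times> 'd)"
    and g :: "real ^ (2 \<times> 'd)"
    and gt v :: "real ^ ('n \<times> 'd)"
  assumes "sym_pos_def H"
    and "P = mat 1 - weighted_pinv H L ** L"
    and "L *v gt = g"
  shows "(mat 1 - P) *v (v - gt) = 0 \<longleftrightarrow> L *v v = g"
proof -
  have "(mat 1 - P) *v (v - gt) = weighted_pinv H L *v (L *v (v - gt))"
    by (simp add: assms(2) matrix_vector_mul_assoc)
  then have "(mat 1 - P) *v (v - gt) = 0 \<longleftrightarrow> L *v (v - gt) = 0"
    using weighted_pinv_Penrose[OF assms(1), of L "v - gt"] by auto
  also have "\<dots> \<longleftrightarrow> L *v v = g"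
    by (simp add: matrix_vector_mult_diff_distrib assms(3))
  finally show ?thesis .
qed

end
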